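(* Let $(V,\mathcal B)$ be a cyclic $(b,v,r,k,\lambda)$-BIBD with $\lambda=1$ and $V=\{0,1,\dots,v-1\}$ that is generated by two base blocks $B=\{b_1,\dots,b_k\}$ and $Y=\{y_1,\dots,y_k\}$. Let $D_1$ and $D_2$ be the multisets of modulo $v$ differences of $B$ and of $Y$, respectively. Let $S=\{0,1,\dots,v-1\}$, $S'=\{0',1',\dots,(v-1)'\}$ (a disjoint copy of $S$), and define $\sigma:S\to S'$ by $\sigma(i)=i'$. Suppose that $V-B$ can be partitioned as $A\cup C$ and $V-Y$ can be partitioned as $X\cup Z$ so that the following three conditions hold: 1. There is a partition of the elements of $A$ into $\binom k2$ unordered pairs $\{a_1,\hat a_1\},\dots,\{a_{\binom k2},\hat a_{\binom k2}\}$ so that $\{\pm(\hat a_i-a_i)\pmod v : 1\le i\le \binom k2\}=D_2$. 2. There is a partition of the elements of $X$ into $\binom k2$ unordered pairs $\{x_1,\hat x_1\},\dots,\{x_{\binom k2},\hat x_{\binom k2}\}$ so that $\{\pm(\hat x_i-x_i)\pmod v : 1\le i\le \binom k2\}=D_1$. 3. There is a bijection $\phi:C\to Z$, where $C=\{c_1,\dots,c_\ell\}$, $Z=\{z_1,\dots,z_\ell\}$ and $\phi(c_i)=z_i$, so that the sets $\{(z_i-c_i)\pmod v:1\le i\le\ell\}$ and $\{(y_j-b_i)\pmod v:1\le i,j\le k\}$ partition $\{0,1,\dots,v-1\}$. Then the following set of base blocks generates, under the addition $\oplus$ modulo $v$, a CURD (with $\lambda=1$) with variety set $S\cup S'$ (so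 $n=2v$ varieties) and partition $m^1 2^{\frac{n-m}{2}}$, where $m=2k$: - the size $m$ base block $\{b_1,\dots,b_k\}\cup\{\sigma(y_1),\dots,\sigma(y_k)\}$; - the size $2$ base blocks $\{a_i,\hat a_i\}$ for $1\le i\le\binom k2$; - the size $2$ base blocks $\{\sigma(x_i),\sigma(\hat x_i)\}$ for $1\le i\le\binom k2$; - the size $2$ base blocks $\{c_i,\sigma(z_i)\}$ for $1\le i\le\ell$.
   Context: BIBD: a design $(V,\mathcal B)$, where $V$ is a finite set of $v$ varieties and $\mathcal B$ is a multiset of $b$ nonempty subsets of $V$ (blocks), is a $(b,v,r,k,\lambda)$-balanced incomplete block design if each variety is in exactly $r$ blocks, each block contains exactly $k$ varieties, each pair of distinct varieties appears together in exactly $\lambda$ blocks, and $k<v$. Cyclic: a block design with variety set $\{0,1,\dots,v-1\}$ is cyclic, generated by a set of base blocks, if its blocks are all the translates of the base blocks obtained by adding $j$ modulo $v$ to every element of a base block, for $j=0,1,\dots,v-1$. Differences: the multiset of modulo $v$ differences of $\{x_1,\dots,x_k\}$ is the multiset $\{\pm(x_i-x_j)\pmod v:1\le i<j\le k\}$, each element being expressed as a nonnegative residue modulo $v$. Addition $\oplus$: for $i,j\in S$, $i\oplus j=i+j\pmod v$ and $\sigma(i)\oplus j=\sigma(i\oplus j)$. A set of base blocks in $S\cup S'$ generates the design whose parallel classes (weeks) are indexed by $j\in\{0,1,\dots,v-1\}$, the $j$-th one consisting of the base blocks with $j$ added (via $\oplus$) to every element. CURD: a pairwise balanced design with index $\lambda$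 is a pair $(W,\mathcal C)$ of a finite set $W$ of varieties and a collection $\mathcal C$ of subsets of $W$ (blocks) such that each pair of distinct varieties appears together in exactly $\lambda$ blocks. It is a Class-Uniformly Resolvable Design (CURD) if $\mathcal C$ is partitioned into parallel classes, each of which contains each variety exactly once, and all parallel classes have the same block sizes (with multiplicity). A CURD on $n$ varieties has partition $m^1 2^{\frac{n-m}{2}}$ if each parallel class consists of exactly one block of size $m$ and $\frac{n-m}{2}$ blocks of size $2$. *)

theory Defs
  imports "HOL-Library.Multiset" "HOL-Library.Disjoint_Sets"
begin

definition blocks_containing :: "'a set multiset \<Rightarrow> 'a set \<Rightarrow> nat" where
  "blocks_containing \<B> X = size {#B \<in># \<B>. X \<subseteq> B#}"

definition bibd :: "'a set \<Rightarrow> 'a set multiset \<Rightarrow> nat \<Rightarrow> nat \<Rightarrow> nat \<Rightarrow> nat \<Rightarrow> nat \<Rightarrow> bool" where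
  "bibd V \<B> b v r k \<Lambda> \<longleftrightarrow>
     finite V \<and> card V = v \<and> size \<B> = b \<and>
     (\<forall>B \<in># \<B>. B \<noteq> {} \<and> B \<subseteq> V) \<and>
     (\<forall>x \<in> V. blocks_containing \<B> {x} = r) \<and>
     (\<forall>B \<in># \<B>. card B = k) \<and>
     (\<forall>x \<in> V. \<forall>y \<in> V. x \<noteq> y \<longrightarrow> blocks_containing \<B> {x, y} = \<Lambda>) \<and>
     k < v"

definition translate :: "nat \<Rightarrow> int \<Rightarrow> int set \<Rightarrow> int set" where
  "translate v j B = (\<lambda>i. (i + j) mod int v) ` B"

text \<open>
  The blocks form a multiset, so every base block contributes exactly \<open>v\<close> blocks, counted with
  multiplicity, one for each \<open>j\<close>.
\<close>
definition cyclic_generated_by :: "nat \<Rightarrow> int set multiset \<Rightarrow> int set multiset \<Rightarrow> bool" where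
  "cyclic_generated_by v \<B> base \<longleftrightarrow>
     (\<forall>B \<in># base. B \<subseteq> {0..<int v}) \<and>
     \<B> = (\<Sum>j \<in> {0..<int v}. image_mset (translate v j) base)"

definition pm_difference :: "nat \<Rightarrow> int \<Rightarrow> int \<Rightarrow> int multiset" where
  "pm_difference v x y = {#(x - y) mod int v, (- (x - y)) mod int v#}"

text \<open>
  Each unordered pair of elements is listed once, through its increasing ordering; since
  \<open>pm_difference\<close> is symmetric in its last two arguments, any enumeration
  \<open>x\<^sub>1, \<dots>, x\<^sub>k\<close> of \<open>X\<close> with pairs \<open>i < j\<close> gives the same multiset.
\<close>
definition mod_differences :: "nat \<Rightarrow> int set \<Rightarrow> int multiset" where
  "mod_differences v X =
     (\<Sum>(x, y) \<in> {(x, y). x \<in> X \<and> y \<in> X \<and> x < y}. pm_difference v x y)"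

definition pairing :: "'a set \<Rightarrow> nat \<Rightarrow> (nat \<Rightarrow> 'a) \<Rightarrow> (nat \<Rightarrow> 'a) \<Rightarrow> bool" where
  "pairing A n a a' \<longleftrightarrow>
     (\<forall>i \<in> {1..n}. a i \<noteq> a' i) \<and>
     disjoint_family_on (\<lambda>i. {a i, a' i}) {1..n} \<and>
     (\<Union>i \<in> {1..n}. {a i, a' i}) = A"

definition pairwise_balanced_design :: "'a set \<Rightarrow> 'a set multiset \<Rightarrow> nat \<Rightarrow> bool" where
  "pairwise_balanced_design W \<C> \<Lambda> \<longleftrightarrow>
     finite W \<and>
     (\<forall>B \<in># \<C>. B \<subseteq> W) \<and>
     (\<forall>x \<in> W. \<forall>y \<in> W. x \<noteq> y \<longrightarrow> blocks_containing \<C> {x, y} = \<Lambda>)"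

definition parallel_class :: "'a set \<Rightarrow> 'a set multiset \<Rightarrow> bool" where
  "parallel_class W P \<longleftrightarrow>
     (\<forall>B \<in># P. B \<subseteq> W) \<and> (\<forall>x \<in> W. blocks_containing P {x} = 1)"

text \<open>The multiset \<open>\<P>\<close> is the chosen partition of the blocks \<open>\<C>\<close> into parallel classes.\<close>
definition curd :: "'a set \<Rightarrow> 'a set multiset \<Rightarrow> 'a set multiset multiset \<Rightarrow> nat \<Rightarrow> bool" where
  "curd W \<C> \<P> \<Lambda> \<longleftrightarrow>
     pairwise_balanced_design W \<C> \<Lambda> \<and>
     \<C> = \<Sum>\<^sub># \<P> \<and>
     (\<forall>P \<in># \<P>. parallel_class W P) \<and>
     (\<forall>P \<in># \<P>. \<forall>Q \<in># \<P>. image_mset card P = image_mset card Q)"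

text \<open>
  For a parallel class the block sizes sum to \<open>card W\<close>, so the truncating \<open>-\<close> and \<open>div\<close> below are
  automatically exact.
\<close>
definition has_partition_m1_2 :: "'a set \<Rightarrow> 'a set multiset multiset \<Rightarrow> nat \<Rightarrow> bool" where
  "has_partition_m1_2 W \<P> m \<longleftrightarrow>
     (\<forall>P \<in># \<P>. image_mset card P = add_mset m (replicate_mset ((card W - m) div 2) 2))"

text \<open>
  A residue \<open>i \<in> S\<close> is represented by \<open>Inl i\<close>, and its primed copy \<open>\<sigma> i \<in> S'\<close> by \<open>Inr i\<close>.
\<close>
abbreviation sigma :: "int \<Rightarrow> int + int" ("\<sigma>") where
  "\<sigma> \<equiv> Inr"

fun oplus :: "nat \<Rightarrow> int + int \<Rightarrow> int \<Rightarrow> int + int" where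
  "oplus v (Inl i) j = Inl ((i + j) mod int v)"
| "oplus v (\<sigma> i) j = \<sigma> ((i + j) mod int v)"

definition week :: "nat \<Rightarrow> (int + int) set multiset \<Rightarrow> int \<Rightarrow> (int + int) set multiset" where
  "week v base j = image_mset (\<lambda>B. (\<lambda>p. oplus v p j) ` B) base"

definition weeks :: "nat \<Rightarrow> (int + int) set multiset \<Rightarrow> (int + int) set multiset multiset" where
  "weeks v base = image_mset (week v base) (mset_set {0..<int v})"

end

theory Submission
  imports Defs
begin

text \<open>
  A block and its \<open>v\<close> translates cover a pair \<open>p \<noteq> q\<close> as often as \<open>p - q\<close> occurs among the
  differences of the block. So the weeks cover a pair inside \<open>S\<close>, or inside \<open>S'\<close>, as often as its
  difference occurs in \<open>D\<^sub>1\<close> and \<open>D\<^sub>2\<close> together, and this is exactly how often the cyclic design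
  covers it, namely once. For a mixed pair the relevant differences are those in condition 3; these
  form sets rather than multisets, but \<open>card C + k\<^sup>2 = v\<close>, so no difference can be repeated.
\<close>

section \<open>Differences between two sets of residues\<close>

text \<open>Two sets are allowed so that mixed pairs, with one residue from each copy, are handled
  too. Counting ordered pairs accounts for both signs in \<open>pm_difference\<close>; for
  \<open>P = Q\<close> the diagonal adds only to \<open>d = 0\<close>.\<close>

definition diff_count :: "nat \<Rightarrow> int set \<Rightarrow> int set \<Rightarrow> int \<Rightarrow> nat" where
  "diff_count v P Q d = card {(s, t). s \<in> P \<and> t \<in> Q \<and> (s - t) mod int v = d}"

lemma diff_count_eq_sum:
  assumes "finite P" "finite Q"
  shows "diff_count v P Q d = (\<Sum>(s, t) \<in> P \<times> Q. of_bool ((s - t) mod int v = d))"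
proof -
  have "{(s, t). s \<in> P \<and> t \<in> Q \<and> (s - t) mod int v = d}
      = (P \<times> Q) \<inter> {(s, t). (s - t) mod int v = d}"
    by auto
  moreover have "(\<Sum>(s, t) \<in> P \<times> Q. of_bool ((s - t) mod int v = d))
      = (\<Sum>p \<in> P \<times> Q. of_bool (p \<in> {(s, t). (s - t) mod int v = d}) :: nat)"
    by (intro sum.cong) auto
  ultimately show ?thesis
    using assms by (simp add: diff_count_def sum_of_bool_eq)
qed

lemma diff_count_empty [simp]: "diff_count v {} Q d = 0" "diff_count v P {} d = 0"
  by (simp_all add: diff_count_def)

lemma diff_count_singletons [simp]:
  "diff_count v {s} {t} d = of_bool ((s - t) mod int v = d)"
  by (simp add: diff_count_eq_sum)

text \<open>The diagonal pairs have difference \<open>0\<close>, so only \<open>(x, y)\<close> and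
  \<open>(y, x)\<close> remain, and these give the two signs.\<close>

lemma diff_count_pair:
  assumes "d \<noteq> 0" "x \<noteq> y"
  shows "diff_count v {x, y} {x, y} d = count (pm_difference v y x) d"
  using assms by (auto simp: diff_count_eq_sum pm_difference_def)

text \<open>Injectivity leaves each residue at most one representation. This makes a condition on
  sets of differences usable where multiplicities matter.\<close>

lemma diff_count_inj_on:
  assumes "inj_on (\<lambda>(s, t). (s - t) mod int v) (P \<times> Q)"
  shows "diff_count v P Q d = of_bool (d \<in> {(s - t) mod int v | s t. s \<in> P \<and> t \<in> Q})"
proof (cases "d \<in> {(s - t) mod int v | s t. s \<in> P \<and> t \<in> Q}")
  case True
  then obtain s t where st: "s \<in> P" "t \<in> Q" "d = (s - t) mod int v"
    by blast
  have "s' = s \<and> t' = t" if "s' \<in> P" "t' \<in> Q" "(s' - t') mod int v = d" for s' t'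
    using inj_onD[OF assms, of "(s', t')" "(s, t)"] st that by simp
  with st have "{(s, t). s \<in> P \<and> t \<in> Q \<and> (s - t) mod int v = d} = {(s, t)}"
    by blast
  then show ?thesis
    using True by (simp add: diff_count_def)
next
  case False
  then have "{(s, t). s \<in> P \<and> t \<in> Q \<and> (s - t) mod int v = d} = {}"
    by auto
  then show ?thesis
    unfolding diff_count_def using False by (simp only: card.empty of_bool_eq)
qed

text \<open>The two orderings of an unordered pair give its two signed differences, and the diagonal
  drops out because \<open>d\<close> is nonzero.\<close>

lemma count_mod_differences:
  assumes "finite P" "d \<noteq> 0"
  shows "count (mod_differences v P) d = diff_count v P P d"
proof -
  let ?f = "\<lambda>(s, t). of_bool ((s - t) mod int v = d) :: nat"
  let ?L = "{(s, t). s \<in> P \<and> t \<in> P \<and> s < t}" and ?G = "{(s, t). s \<in> P \<and> t \<in> P \<and> t < s}"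
  have fin: "finite ?L" "finite ?G"
    using assms(1) by (auto intro: finite_subset[of _ "P \<times> P"])
  have "diff_count v P P d = sum ?f (P \<times> P)"
    using assms by (simp add: diff_count_eq_sum)
  also have "\<dots> = sum ?f (?L \<union> ?G)"
    using assms by (intro sum.mono_neutral_right) (auto, metis diff_self linorder_neqE mod_0)
  also have "\<dots> = sum ?f ?L + sum ?f ?G"
    using fin by (intro sum.union_disjoint) auto
  \<comment> \<open>Swapping coordinates sends the decreasing pairs to the increasing ones, where
    they supply the opposite sign.\<close>
  also have "sum ?f ?G = (\<Sum>(s, t) \<in> ?L. ?f (t, s))"
    by (rule sum.reindex_bij_witness[of _ prod.swap prod.swap]) auto
  also have "sum ?f ?L + (\<Sum>(s, t) \<in> ?L. ?f (t, s))
      = (\<Sum>(s, t) \<in> ?L. count (pm_difference v s t) d)"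
    by (auto simp: sum.distrib[symmetric] pm_difference_def intro!: sum.cong)
  also have "\<dots> = count (mod_differences v P) d"
    by (simp add: mod_differences_def count_sum case_prod_unfold)
  finally show ?thesis ..
qed

section \<open>Counting the translates that cover a pair\<close>

text \<open>A shift \<open>j\<close> is determined by the element \<open>s = p - j\<close> that it
  moves to \<open>p\<close>; then \<open>t = q - j\<close> satisfies \<open>s - t = p - q\<close>
  modulo \<open>v\<close>. Conversely, \<open>(s, t)\<close> gives back
  \<open>j = p - s\<close>.\<close>

lemma card_translations_eq_diff_count:
  assumes "P \<subseteq> {0..<int v}" "Q \<subseteq> {0..<int v}" "p \<in> {0..<int v}" "q \<in> {0..<int v}"
  shows "card {j \<in> {0..<int v}. (p - j) mod int v \<in> P \<and> (q - j) mod int v \<in> Q}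
    = diff_count v P Q ((p - q) mod int v)"
proof -
  have inv: "(p - (p - j) mod int v) mod int v = j" if "j \<in> {0..<int v}" for p j
    using that by (simp add: mod_diff_right_eq)
  show ?thesis
    unfolding diff_count_def
  proof (rule bij_betw_same_card,
      rule bij_betw_byWitness[where f' = "\<lambda>(s, t). (p - s) mod int v"])
    show "\<forall>j \<in> {j \<in> {0..<int v}. (p - j) mod int v \<in> P \<and> (q - j) mod int v \<in> Q}.
        (\<lambda>(s, t). (p - s) mod int v) ((p - j) mod int v, (q - j) mod int v) = j"
      using inv by auto
    \<comment> \<open>Modulo \<open>v\<close>,
      \<open>q - (p - s) = s - (p - q) = s - (s - t) = t\<close>; since \<open>t\<close> is a
      reduced residue, the congruence becomes an equality.\<close>
    have snd_eq: "(q - (p - s) mod int v) mod int v = t"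
      if "t \<in> Q" "(s - t) mod int v = (p - q) mod int v" for s t
    proof -
      have "(q - (p - s) mod int v) mod int v = (s - (p - q) mod int v) mod int v"
        by (simp add: mod_diff_right_eq algebra_simps)
      also have "\<dots> = t mod int v"
        unfolding that(2)[symmetric] by (simp add: mod_diff_right_eq)
      finally show ?thesis
        using that(1) assms by auto
    qed
    show "\<forall>a \<in> {(s, t). s \<in> P \<and> t \<in> Q \<and> (s - t) mod int v = (p - q) mod int v}.
        ((p - (case a of (s, t) \<Rightarrow> (p - s) mod int v)) mod int v,
         (q - (case a of (s, t) \<Rightarrow> (p - s) mod int v)) mod int v) = a"
      using inv snd_eq assms(1) by auto
    show "(\<lambda>j. ((p - j) mod int v, (q - j) mod int v)) `
        {j \<in> {0..<int v}. (p - j) mod int v \<in> P \<and> (q - j) mod int v \<in> Q}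
        \<subseteq> {(s, t). s \<in> P \<and> t \<in> Q \<and> (s - t) mod int v = (p - q) mod int v}"
      by (auto simp: mod_diff_eq)
    show "(\<lambda>(s, t). (p - s) mod int v) `
        {(s, t). s \<in> P \<and> t \<in> Q \<and> (s - t) mod int v = (p - q) mod int v}
        \<subseteq> {j \<in> {0..<int v}. (p - j) mod int v \<in> P \<and> (q - j) mod int v \<in> Q}"
      using inv snd_eq assms by (auto simp: subset_iff)
  qed
qed

lemma blocks_containing_eq_sum:
  "blocks_containing M T = (\<Sum>U \<in># M. of_bool (T \<subseteq> U))"
  unfolding blocks_containing_def by (induction M) auto

text \<open>Double counting: the sums over shifts and over base blocks are exchanged. The family
  \<open>g\<close> is arbitrary since it stands both for \<open>translate v\<close> and for the
  action of \<open>oplus\<close>.\<close>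

lemma blocks_containing_orbit:
  assumes "finite J"
  shows "blocks_containing (\<Sum>j \<in> J. image_mset (g j) M) T
    = (\<Sum>U \<in># M. card {j \<in> J. T \<subseteq> g j U})"
proof -
  have "blocks_containing (\<Sum>j \<in> J. image_mset (g j) M) T
      = (\<Sum>j \<in> J. \<Sum>U \<in># M. of_bool (T \<subseteq> g j U))"
    using assms
    by (induction J) (auto simp: blocks_containing_eq_sum image_mset.compositionality comp_def)
  also have "\<dots> = (\<Sum>U \<in># M. \<Sum>j \<in> J. of_bool (T \<subseteq> g j U))"
    by (induction M) (auto simp: sum.distrib)
  also have "\<dots> = (\<Sum>U \<in># M. card {j \<in> J. T \<subseteq> g j U})"
    using assms by (simp add: sum_of_bool_eq Collect_conj_eq)
  finally show ?thesis .
qed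

lemma mem_translate_iff:
  assumes "U \<subseteq> {0..<int v}" "p \<in> {0..<int v}"
  shows "p \<in> translate v j U \<longleftrightarrow> (p - j) mod int v \<in> U"
proof
  assume "p \<in> translate v j U"
  then obtain u where "u \<in> U" "p = (u + j) mod int v"
    by (auto simp: translate_def)
  then show "(p - j) mod int v \<in> U"
    using assms(1) by (auto simp: mod_diff_left_eq)
next
  assume "(p - j) mod int v \<in> U"
  moreover have "p = ((p - j) mod int v + j) mod int v"
    using assms(2) by (simp add: mod_add_left_eq)
  ultimately show "p \<in> translate v j U"
    unfolding translate_def by (rule rev_image_eqI)
qed

text \<open>Each copy of the residues is invariant under \<open>oplus\<close>, which acts there by
  ordinary translation, so facts on \<open>translate\<close> carry over to the trace of a block on
  either copy.\<close>

lemma vimage_oplus_image: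
  assumes "f \<in> {Inl, Inr}"
  shows "f -` ((\<lambda>p. oplus v p j) ` U) = translate v j (f -` U)"
proof -
  have oplus_eq: "f i = oplus v p j \<longleftrightarrow> (\<exists>u. p = f u \<and> i = (u + j) mod int v)" for p i
    using assms by (cases p) auto
  show ?thesis
    unfolding translate_def set_eq_iff vimage_eq image_iff Bex_def oplus_eq by blast
qed

text \<open>This turns the pair condition of the BIBD into a condition on the differences of the
  base blocks.\<close>

lemma blocks_containing_cyclic:
  assumes "cyclic_generated_by v \<B> base" "p \<in> {0..<int v}" "q \<in> {0..<int v}"
  shows "blocks_containing \<B> {p, q} = (\<Sum>U \<in># base. diff_count v U U ((p - q) mod int v))"
proof -
  have base: "U \<subseteq> {0..<int v}" if "U \<in># base" for U
    using assms(1) that by (auto simp: cyclic_generated_by_def)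
  have "blocks_containing \<B> {p, q}
      = (\<Sum>U \<in># base. card {j \<in> {0..<int v}. {p, q} \<subseteq> translate v j U})"
    unfolding conjunct2[OF assms(1)[unfolded cyclic_generated_by_def]]
    by (rule blocks_containing_orbit) simp
  also have "\<dots> = (\<Sum>U \<in># base. diff_count v U U ((p - q) mod int v))"
  proof (intro arg_cong[where f = sum_mset] image_mset_cong)
    fix U assume U: "U \<in># base"
    show "card {j \<in> {0..<int v}. {p, q} \<subseteq> translate v j U} = diff_count v U U ((p - q) mod int v)"
      using card_translations_eq_diff_count[OF base[OF U] base[OF U] assms(2,3)]
      by (simp add: mem_translate_iff[OF base[OF U] assms(2)] mem_translate_iff[OF base[OF U] assms(3)])
  qed
  finally show ?thesis .
qed

text \<open>Letting \<open>f\<close> and \<open>g\<close> range over both injections treats pairs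
  inside either copy and mixed pairs at once.\<close>

lemma blocks_containing_weeks:
  assumes f: "f \<in> {Inl, Inr}" and g: "g \<in> {Inl, Inr}"
    and pq: "p \<in> {0..<int v}" "q \<in> {0..<int v}"
    and base: "\<And>U. U \<in># base \<Longrightarrow> U \<subseteq> Inl ` {0..<int v} \<union> Inr ` {0..<int v}"
  shows "blocks_containing (\<Sum>\<^sub># (weeks v base)) {f p, g q}
    = (\<Sum>U \<in># base. diff_count v (f -` U) (g -` U) ((p - q) mod int v))"
proof -
  have sub: "h -` U \<subseteq> {0..<int v}" if "h \<in> {Inl, Inr}" "U \<in># base" for h U
    using base[OF that(2)] that(1) by auto
  have mem: "h i \<in> (\<lambda>p. oplus v p j) ` U \<longleftrightarrow> (i - j) mod int v \<in> h -` U"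
    if "h \<in> {Inl, Inr}" "U \<in># base" "i \<in> {0..<int v}" for h U i j
    using mem_translate_iff[OF sub[OF that(1,2)] that(3), of j] vimage_oplus_image[OF that(1), of v j U]
    by auto
  have "\<Sum>\<^sub># (weeks v base)
      = (\<Sum>j \<in> {0..<int v}. image_mset (\<lambda>B. (\<lambda>p. oplus v p j) ` B) base)"
    unfolding weeks_def week_def by (simp add: sum_unfold_sum_mset)
  then have "blocks_containing (\<Sum>\<^sub># (weeks v base)) {f p, g q}
      = (\<Sum>U \<in># base. card {j \<in> {0..<int v}. {f p, g q} \<subseteq> (\<lambda>p. oplus v p j) ` U})"
    by (simp only: blocks_containing_orbit finite_atLeastLessThan_int)
  also have "\<dots> = (\<Sum>U \<in># base. diff_count v (f -` U) (g -` U) ((p - q) mod int v))"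
  proof (intro arg_cong[where f = sum_mset] image_mset_cong)
    fix U assume U: "U \<in># base"
    show "card {j \<in> {0..<int v}. {f p, g q} \<subseteq> (\<lambda>p. oplus v p j) ` U}
        = diff_count v (f -` U) (g -` U) ((p - q) mod int v)"
      using card_translations_eq_diff_count[OF sub[OF f U] sub[OF g U] pq]
      by (simp add: mem[OF f U pq(1)] mem[OF g U pq(2)])
  qed
  finally show ?thesis .
qed

section \<open>Properties that every week inherits from the base week\<close>

lemma blocks_containing_week:
  assumes f: "f \<in> {Inl, Inr}" and p: "p \<in> {0..<int v}"
    and base: "\<And>U. U \<in># base \<Longrightarrow> U \<subseteq> Inl ` {0..<int v} \<union> Inr ` {0..<int v}"
  shows "blocks_containing (week v base j) {f p} = blocks_containing base {f ((p - j) mod int v)}"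
proof -
  have "f p \<in> (\<lambda>p. oplus v p j) ` U \<longleftrightarrow> f ((p - j) mod int v) \<in> U" if "U \<in># base" for U
  proof -
    have "f -` U \<subseteq> {0..<int v}"
      using base[OF that] f by auto
    from mem_translate_iff[OF this p, of j] show ?thesis
      using vimage_oplus_image[OF f, of v j U] by auto
  qed
  then show ?thesis
    unfolding blocks_containing_eq_sum week_def
    by (auto simp: image_mset.compositionality comp_def
        intro!: arg_cong[where f = sum_mset] image_mset_cong)
qed

text \<open>Shifting back by \<open>j\<close> maps each variety to a variety of the same copy, so
  single coverage passes from the base week to every week.\<close>

lemma parallel_class_week:
  assumes base: "parallel_class (Inl ` {0..<int v} \<union> Inr ` {0..<int v}) M"
  shows "parallel_class (Inl ` {0..<int v} \<union> Inr ` {0..<int v}) (week v M j)"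
    (is "parallel_class ?W _")
proof -
  have sub: "\<And>U. U \<in># M \<Longrightarrow> U \<subseteq> ?W" and one: "\<And>p. p \<in> ?W \<Longrightarrow> blocks_containing M {p} = 1"
    using base unfolding parallel_class_def by blast+
  have closed: "oplus v p j \<in> ?W" if "p \<in> ?W" for p
    using that by auto
  show ?thesis
    unfolding parallel_class_def
  proof (intro conjI ballI)
    fix U assume "U \<in># week v M j"
    then obtain U' where "U' \<in># M" and U: "U = (\<lambda>p. oplus v p j) ` U'"
      unfolding week_def by auto
    then show "U \<subseteq> ?W"
      unfolding U by (intro image_subsetI closed subsetD[OF sub])
  next
    fix w assume "w \<in> ?W"
    then obtain f :: "int \<Rightarrow> int + int" and p
      where w: "f \<in> {Inl, Inr}" "w = f p" "p \<in> {0..<int v}"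
      by blast
    have "f ((p - j) mod int v) \<in> ?W"
      using w by auto
    then show "blocks_containing (week v M j) {w} = 1"
      using blocks_containing_week[OF w(1,3) sub, of M j] one w(2) by simp
  qed
qed

lemma inj_on_oplus: "inj_on (\<lambda>p. oplus v p j) (Inl ` {0..<int v} \<union> Inr ` {0..<int v})"
proof -
  have *: "i = i'" if "(i + j) mod int v = (i' + j) mod int v" "i \<in> {0..<int v}" "i' \<in> {0..<int v}"
    for i i'
    using that by (metis add_diff_cancel_right' atLeastLessThan_iff mod_diff_left_eq mod_pos_pos_trivial)
  show ?thesis
    by (rule inj_onI) (auto intro: *)
qed

text \<open>A shift is injective on the varieties, so no block loses elements.\<close>

lemma image_mset_card_week:
  assumes "\<And>U. U \<in># M \<Longrightarrow> U \<subseteq> Inl ` {0..<int v} \<union> Inr ` {0..<int v}"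
  shows "image_mset card (week v M j) = image_mset card M"
  unfolding week_def image_mset.compositionality comp_def
  by (intro image_mset_cong card_image inj_on_subset[OF inj_on_oplus] assms)

section \<open>Partitions into pairs\<close>

lemma card_pairing:
  assumes "pairing A n a a'"
  shows "card A = 2 * n"
proof -
  have A: "A = (\<Union>i \<in> {1..n}. {a i, a' i})"
    using assms by (simp add: pairing_def)
  have "card A = (\<Sum>i \<in> {1..n}. card {a i, a' i})"
    unfolding A by (rule card_UN_disjoint) (use assms in \<open>auto simp: pairing_def disjoint_family_on_def\<close>)
  also have "\<dots> = (\<Sum>i \<in> {1..n}. 2)"
    using assms by (intro sum.cong) (auto simp: pairing_def)
  finally show ?thesis by simp
qed

text \<open>Disjointness of the pairs allows at most one index, and their union being
  \<open>A\<close> provides one when \<open>p \<in> A\<close>.\<close>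

lemma sum_of_bool_pairing:
  assumes "pairing A n a a'"
  shows "(\<Sum>i = 1..n. of_bool (p = a i \<or> p = a' i)) = (of_bool (p \<in> A) :: nat)"
proof -
  let ?I = "{i \<in> {1..n}. p = a i \<or> p = a' i}"
  have "(\<Sum>i = 1..n. of_bool (p = a i \<or> p = a' i)) = card ?I"
    by (simp only: sum_of_bool_eq finite_atLeastAtMost Collect_conj_eq Collect_mem_eq of_nat_id)
  also have "\<dots> = of_bool (p \<in> A)"
  proof (cases "p \<in> A")
    case True
    then obtain i where i: "i \<in> {1..n}" "p \<in> {a i, a' i}"
      using assms unfolding pairing_def by blast
    have "?I = {i}"
      using i assms unfolding pairing_def disjoint_family_on_def by blast
    then show ?thesis using True by simp
  next
    case False
    then have "?I = {}"
      using assms unfolding pairing_def by blast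
    then show ?thesis using False by (simp only: card.empty of_bool_eq)
  qed
  finally show ?thesis .
qed

theorem theorem3p2:
  fixes b v r k :: nat
    and \<B> :: "int set multiset"
    and B Y A C X Z :: "int set"
    and a a' x x' :: "nat \<Rightarrow> int"
    and \<phi> :: "int \<Rightarrow> int"
  assumes "bibd {0..<int v} \<B> b v r k 1"
    and "cyclic_generated_by v \<B> {#B, Y#}"
    and "A \<union> C = {0..<int v} - B" and "A \<inter> C = {}"
    and "X \<union> Z = {0..<int v} - Y" and "X \<inter> Z = {}"
    and "pairing A (k choose 2) a a'"
    and "(\<Sum>i = 1..k choose 2. pm_difference v (a' i) (a i)) = mod_differences v Y"
    and "pairing X (k choose 2) x x'"
    and "(\<Sum>i = 1..k choose 2. pm_difference v (x' i) (x i)) = mod_differences v B"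
    and "bij_betw \<phi> C Z"
    and "{(\<phi> c - c) mod int v | c. c \<in> C} \<union> {(y - b) mod int v | y b. y \<in> Y \<and> b \<in> B}
           = {0..<int v}"
    and "{(\<phi> c - c) mod int v | c. c \<in> C} \<inter> {(y - b) mod int v | y b. y \<in> Y \<and> b \<in> B} = {}"
  shows "let W = Inl ` {0..<int v} \<union> \<sigma> ` {0..<int v};
             base = {#Inl ` B \<union> \<sigma> ` Y#}
                  + {#{Inl (a i), Inl (a' i)}. i \<in># mset_set {1..k choose 2}#}
                  + {#{\<sigma> (x i), \<sigma> (x' i)}. i \<in># mset_set {1..k choose 2}#}
                  + {#{Inl c, \<sigma> (\<phi> c)}. c \<in># mset_set C#}
         in card W = 2 * v \<and>
            curd W (\<Sum>\<^sub># (weeks v base)) (weeks v base) 1 \<and>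
            has_partition_m1_2 W (weeks v base) (2 * k)"
proof -
  let ?n = "k choose 2" and ?V = "{0..<int v}"
  define W where "W = (Inl ` ?V \<union> \<sigma> ` ?V :: (int + int) set)"
  define base where "base = {#Inl ` B \<union> \<sigma> ` Y#}
                  + {#{Inl (a i), Inl (a' i)}. i \<in># mset_set {1..?n}#}
                  + {#{\<sigma> (x i), \<sigma> (x' i)}. i \<in># mset_set {1..?n}#}
                  + {#{Inl c, \<sigma> (\<phi> c)}. c \<in># mset_set C#}"
  note bibd = assms(1)[unfolded bibd_def] and cyclic = assms(2)
  have kv: "k < v" and v: "v > 0"
    using bibd by auto
  have BY: "B \<subseteq> ?V" "Y \<subseteq> ?V"
    using cyclic by (auto simp: cyclic_generated_by_def)
  have fin: "finite B" "finite Y" "finite A" "finite C" "finite X" "finite Z"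
    using BY assms(3,5) by (auto intro: finite_subset[of _ ?V])
  have ACXZ: "A \<subseteq> ?V" "C \<subseteq> ?V" "X \<subseteq> ?V" "Z \<subseteq> ?V"
    using assms(3,5) by auto
  have mem: "a i \<in> A" "a' i \<in> A" "x i \<in> X" "x' i \<in> X" "a i \<noteq> a' i" "x i \<noteq> x' i"
    if "i \<in> {1..?n}" for i
    using assms(7,9) that unfolding pairing_def by blast+
  have phi: "\<phi> c \<in> Z" if "c \<in> C" for c
    using assms(11) that by (auto simp: bij_betw_def)

  \<comment> \<open>The blocks are known only as translates; the shift \<open>0\<close> exhibits
    \<open>B\<close> and \<open>Y\<close> themselves as blocks, so both have \<open>k\<close>
    elements.\<close>
  have translate0: "translate v 0 U = U" if "U \<subseteq> ?V" for U
    using mem_translate_iff[OF that, of _ 0] that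
    by (auto simp: translate_def image_iff subset_iff intro!: bexI)
  have "\<B> = (\<Sum>j \<in> ?V. image_mset (translate v j) {#B, Y#})"
    using cyclic by (simp add: cyclic_generated_by_def)
  then have "image_mset (translate v 0) {#B, Y#} \<subseteq># \<B>"
    using v by (simp add: sum.remove[of _ 0])
  then have "B \<in># \<B>" "Y \<in># \<B>"
    using translate0[OF BY(1)] translate0[OF BY(2)]
    by (auto dest: mset_subset_eqD[of _ _ B] mset_subset_eqD[of _ _ Y])
  then have cardBY: "card B = k" "card Y = k"
    using bibd by auto
  \<comment> \<open>This is \<open>2 * (k choose 2) = k * (k - 1)\<close> with the subtraction moved
    across. With \<open>cardC\<close> below it yields \<open>card C + k * k = v\<close>.\<close>
  have two: "2 * ?n + k = k * k"
    by (cases k) (auto simp: choose_two)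
  have "card A + card C = card (?V - B)"
    unfolding assms(3)[symmetric] using fin(3,4) assms(4) by (rule card_Un_disjoint[symmetric])
  also have "\<dots> = v - k"
    using fin BY cardBY by (simp add: card_Diff_subset)
  finally have cardC: "card C + 2 * ?n = v - k"
    using card_pairing[OF assms(7)] by simp

  have sub: "U \<subseteq> W" if "U \<in># base" for U
  proof -
    have "U = Inl ` B \<union> \<sigma> ` Y \<or> U \<in> (\<lambda>i. {Inl (a i), Inl (a' i)}) ` {1..?n}
        \<or> U \<in> (\<lambda>i. {\<sigma> (x i), \<sigma> (x' i)}) ` {1..?n} \<or> U \<in> (\<lambda>c. {Inl c, \<sigma> (\<phi> c)}) ` C"
      using that fin(4) unfolding base_def by simp
    then consider "U = Inl ` B \<union> \<sigma> ` Y" | i where "i \<in> {1..?n}" "U = {Inl (a i), Inl (a' i)}"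
      | i where "i \<in> {1..?n}" "U = {\<sigma> (x i), \<sigma> (x' i)}" | c where "c \<in> C" "U = {Inl c, \<sigma> (\<phi> c)}"
      by blast
    then show ?thesis
    proof cases
      case 1
      then show ?thesis
        using BY unfolding W_def by blast
    next
      case (2 i)
      then show ?thesis
        using mem(1,2)[of i] ACXZ unfolding W_def by blast
    next
      case (3 i)
      then show ?thesis
        using mem(3,4)[of i] ACXZ unfolding W_def by blast
    next
      case (4 c)
      then show ?thesis
        using phi[of c] ACXZ unfolding W_def by blast
    qed
  qed

  \<comment> \<open>\<open>F\<close> is arbitrary because the expansion serves both for points in
    the base week and for pairs in all weeks.\<close>
  have sum_base: "(\<Sum>U \<in># base. F U) = F (Inl ` B \<union> \<sigma> ` Y)
      + (\<Sum>i = 1..?n. F {Inl (a i), Inl (a' i)}) + (\<Sum>i = 1..?n. F {\<sigma> (x i), \<sigma> (x' i)})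
      + (\<Sum>c \<in> C. F {Inl c, \<sigma> (\<phi> c)})" for F :: "(int + int) set \<Rightarrow> nat"
    unfolding base_def by (simp add: sum_unfold_sum_mset image_mset.compositionality comp_def)

  \<comment> \<open>The base week is a parallel class\<close>
  have parallel: "parallel_class W base"
    unfolding parallel_class_def
  proof (intro conjI ballI sub)
    fix w assume "w \<in> W"
    then consider p where "w = Inl p" "p \<in> ?V" | p where "w = Inr p" "p \<in> ?V"
      unfolding W_def by auto
    then show "blocks_containing base {w} = 1"
    proof cases
      case 1
      have "(\<Sum>c \<in> C. of_bool (p = c)) = (of_bool (p \<in> C) :: nat)"
        using fin by (simp add: of_bool_def)
      \<comment> \<open>Since \<open>B\<close>, \<open>A\<close> and \<open>C\<close> partition the
        residues, exactly one of the three terms is \<open>1\<close>.\<close>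
      then have "blocks_containing base {w} = of_bool (p \<in> B) + of_bool (p \<in> A) + of_bool (p \<in> C)"
        using 1 sum_of_bool_pairing[OF assms(7), of p]
        by (simp add: blocks_containing_eq_sum sum_base image_iff)
      then show ?thesis
        using 1 assms(3,4) by auto
    next
      case 2
      \<comment> \<open>The primed ends of the mixed blocks run through \<open>Z\<close> once each,
        as \<open>\<phi>\<close> is a bijection.\<close>
      have "(\<Sum>c \<in> C. of_bool (p = \<phi> c)) = (\<Sum>z \<in> Z. of_bool (p = z) :: nat)"
        by (rule sum.reindex_bij_betw[OF assms(11)])
      also have "\<dots> = of_bool (p \<in> Z)"
        using fin by (simp add: of_bool_def)
      finally have "blocks_containing base {w} = of_bool (p \<in> Y) + of_bool (p \<in> X) + of_bool (p \<in> Z)"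
        using 2 sum_of_bool_pairing[OF assms(9), of p]
        by (simp add: blocks_containing_eq_sum sum_base image_iff)
      then show ?thesis
        using 2 assms(5,6) by auto
    qed
  qed

  \<comment> \<open>Distinctness of the mixed differences\<close>
  let ?D = "{(y - b) mod int v | y b. y \<in> Y \<and> b \<in> B}" and ?E = "{(\<phi> c - c) mod int v | c. c \<in> C}"
  have D_eq: "?D = (\<lambda>(y, b). (y - b) mod int v) ` (Y \<times> B)"
    and E_eq: "?E = (\<lambda>c. (\<phi> c - c) mod int v) ` C"
    by auto
  have "card ?E + card ?D = v"
    using assms(12,13) fin unfolding D_eq E_eq
    by (subst card_Un_disjoint[symmetric]) auto
  moreover have "card ?D \<le> card (Y \<times> B)" "card ?E \<le> card C"
    using fin unfolding D_eq E_eq by (simp_all only: card_image_le finite_cartesian_product)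
  moreover have "card (Y \<times> B) = k * k"
    by (simp add: card_cartesian_product cardBY)
  \<comment> \<open>Together the two images have \<open>v = k * k + card C\<close> elements, so
    neither upper bound is strict. A map on a finite set whose image is as large as its domain is
    injective.\<close>
  ultimately have "card ?D = card (Y \<times> B)" "card ?E = card C"
    using cardC two kv by linarith+
  then have injD: "inj_on (\<lambda>(y, b). (y - b) mod int v) (Y \<times> B)"
    and injE: "inj_on (\<lambda>c. (\<phi> c - c) mod int v) C"
    using fin unfolding D_eq E_eq by (simp_all only: eq_card_imp_inj_on finite_cartesian_product)

  \<comment> \<open>Coverage of pairs of varieties\<close>
  have D12: "diff_count v B B d + diff_count v Y Y d = 1" if "d \<in> ?V" "d \<noteq> 0" for d
  proof -
    \<comment> \<open>The pair \<open>{d, 0}\<close> is a representative of the pairs with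
      difference \<open>d\<close>.\<close>
    have "blocks_containing \<B> {d, 0} = 1"
      using bibd that by auto
    then show ?thesis
      using blocks_containing_cyclic[OF cyclic that(1), of 0] that by auto
  qed
  \<comment> \<open>Applied crosswise: the pairs from \<open>A\<close> supply the differences of
    \<open>Y\<close>, and those from \<open>X\<close> the differences of \<open>B\<close>.\<close>
  have countD: "(\<Sum>i = 1..n. diff_count v {s i, s' i} {s i, s' i} d) = diff_count v U U d"
    if "pairing P n s s'" "finite U" "d \<noteq> 0"
      "(\<Sum>i = 1..n. pm_difference v (s' i) (s i)) = mod_differences v U" for P U n s s' d
  proof -
    have "(\<Sum>i = 1..n. diff_count v {s i, s' i} {s i, s' i} d)
        = (\<Sum>i = 1..n. count (pm_difference v (s' i) (s i)) d)"
      using that by (intro sum.cong diff_count_pair) (auto simp: pairing_def)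
    also have "\<dots> = count (mod_differences v U) d"
      by (simp add: that(4)[symmetric] count_sum)
    finally show ?thesis
      using count_mod_differences[OF that(2,3)] by simp
  qed
  have vimages:
    "Inl -` (Inl ` P :: (int + int) set) = P" "Inr -` (Inl ` P :: (int + int) set) = {}"
    "Inl -` (Inr ` P :: (int + int) set) = {}" "Inr -` (Inr ` P :: (int + int) set) = P"
    "Inl -` {Inl s, Inl t :: int + int} = {s, t}" "Inr -` {Inl s, Inl t :: int + int} = {}"
    "Inl -` {Inr s, Inr t :: int + int} = {}" "Inr -` {Inr s, Inr t :: int + int} = {s, t}"
    "Inl -` {Inl s, Inr t :: int + int} = {s}" "Inr -` {Inl s, Inr t :: int + int} = {t}" for P s t
    by auto
  note weeks_count = blocks_containing_weeks[of _ _ _ v _ base, OF _ _ _ _ sub[unfolded W_def],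
      unfolded sum_base]
  have same: "blocks_containing (\<Sum>\<^sub># (weeks v base)) {f p, f q} = 1"
    if "f \<in> {Inl, Inr}" "p \<in> ?V" "q \<in> ?V" "p \<noteq> q" for f p q
  proof -
    have "p mod int v \<noteq> q mod int v"
      using that(2-4) by simp
    then have d: "(p - q) mod int v \<in> ?V" "(p - q) mod int v \<noteq> 0"
      using v by (simp_all add: mod_eq_dvd_iff mod_eq_0_iff_dvd)
    show ?thesis
      \<comment> \<open>On the first copy the large block contributes the differences of
        \<open>B\<close> and the pairs from \<open>A\<close> those of \<open>Y\<close>; on the
        second copy it contributes those of \<open>Y\<close>, and the pairs from \<open>X\<close>
        those of \<open>B\<close>. A block \<open>{Inl c, \<sigma> (\<phi> c)}\<close> has one point
        on each copy and adds nothing. Either way the total is that of \<open>D12\<close>.\<close>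
      using that(1) weeks_count[OF that(1,1-3)] D12[OF d] fin
        countD[OF assms(7) fin(2) d(2) assms(8)] countD[OF assms(9) fin(1) d(2) assms(10)] d(2)
      by (auto simp: vimages simp del: mod_eq_0_iff_dvd)
  qed
  \<comment> \<open>Placing \<open>Inr q\<close> first makes the difference \<open>q - p\<close>, in
    the orientation of \<open>\<phi> c - c\<close> and \<open>y - b\<close>.\<close>
  have mixed: "blocks_containing (\<Sum>\<^sub># (weeks v base)) {Inr q, Inl p} = 1"
    if "p \<in> ?V" "q \<in> ?V" for p q
  proof -
    let ?d = "(q - p) mod int v"
    \<comment> \<open>By \<open>injE\<close> no difference is repeated, so counting over
      \<open>C\<close> amounts to testing membership in \<open>?E\<close>.\<close>
    have "(\<Sum>c \<in> C. of_bool ((\<phi> c - c) mod int v = ?d)) = (\<Sum>e \<in> ?E. of_bool (e = ?d) :: nat)"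
      unfolding E_eq by (simp add: sum.reindex[OF injE])
    also have "\<dots> = of_bool (?d \<in> ?E)"
      unfolding E_eq using fin by (simp add: of_bool_def)
    finally have "blocks_containing (\<Sum>\<^sub># (weeks v base)) {Inr q, Inl p}
        = of_bool (?d \<in> ?D) + of_bool (?d \<in> ?E)"
      using weeks_count[of Inr Inl q p] that diff_count_inj_on[OF injD, of ?d]
      by (simp add: vimages)
    moreover have "?d \<in> ?E \<union> ?D"
      unfolding assms(12) using v by simp
    ultimately show ?thesis
      using assms(13) by auto
  qed
  have par: "parallel_class W P" if "P \<in># weeks v base" for P
    using that parallel_class_week[OF parallel[unfolded W_def]] unfolding weeks_def W_def by auto
  have pbd: "pairwise_balanced_design W (\<Sum>\<^sub># (weeks v base)) 1"
    unfolding pairwise_balanced_design_def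
  proof (intro conjI ballI impI)
    show "finite W"
      by (simp add: W_def)
    fix U assume "U \<in># \<Sum>\<^sub># (weeks v base)"
    then obtain P where "P \<in># weeks v base" "U \<in># P"
      by auto
    then show "U \<subseteq> W"
      using par unfolding parallel_class_def by blast
  next
    fix w w' assume "w \<in> W" "w' \<in> W" "w \<noteq> w'"
    \<comment> \<open>Since \<open>{w, w'}\<close> is unordered, the second case absorbs both orders
      of a mixed pair.\<close>
    then consider f p q where "f \<in> {Inl, Inr}" "w = f p" "w' = f q" "p \<in> ?V" "q \<in> ?V"
      | p q where "{w, w'} = {Inr q, Inl p}" "p \<in> ?V" "q \<in> ?V"
      unfolding W_def by blast
    then show "blocks_containing (\<Sum>\<^sub># (weeks v base)) {w, w'} = 1"
      using same mixed \<open>w \<noteq> w'\<close> by cases auto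
  qed

  \<comment> \<open>Block sizes\<close>
  have cardW: "card W = 2 * v"
    unfolding W_def by (subst card_Un_disjoint) (auto simp: card_image)
  have const: "{#g i. i \<in># mset_set {1..?n}#} = replicate_mset ?n 2"
    if "\<And>i. i \<in> {1..?n} \<Longrightarrow> g i = 2" for g :: "nat \<Rightarrow> nat"
  proof -
    have "{#g i. i \<in># mset_set {1..?n}#} = {#2. i \<in># mset_set {1..?n}#}"
      using that by (intro image_mset_cong) simp
    then show ?thesis
      by (simp add: image_mset_const_eq)
  qed
  have "card (Inl ` B \<union> \<sigma> ` Y :: (int + int) set) = 2 * k"
    using fin cardBY by (subst card_Un_disjoint) (auto simp: card_image)
  moreover have "{#card {Inl (a i), Inl (a' i) :: int + int}. i \<in># mset_set {1..?n}#} = replicate_mset ?n 2"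
    "{#card {\<sigma> (x i), \<sigma> (x' i)}. i \<in># mset_set {1..?n}#} = replicate_mset ?n 2"
    by (rule const, simp add: mem(5,6))+
  \<comment> \<open>By \<open>cardC\<close> the left side is \<open>v - k\<close>, which is half of
    \<open>2 * v - 2 * k\<close>.\<close>
  moreover have "?n + ?n + card C = (card W - 2 * k) div 2"
    using cardC kv cardW by simp
  moreover have "replicate_mset (?n + ?n + card C) 2
      = replicate_mset ?n 2 + replicate_mset ?n 2 + replicate_mset (card C) (2 :: nat)"
    by (simp add: multiset_eq_iff)
  ultimately have sizes: "image_mset card base
      = add_mset (2 * k) (replicate_mset ((card W - 2 * k) div 2) 2)"
    unfolding base_def
    by (simp add: image_mset.compositionality comp_def image_mset_const_eq numeral_2_eq_2)
  have week_sizes: "image_mset card P = image_mset card base" if "P \<in># weeks v base" for P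
    using that image_mset_card_week[OF sub[unfolded W_def]] by (auto simp: weeks_def)
  have "curd W (\<Sum>\<^sub># (weeks v base)) (weeks v base) 1"
    unfolding curd_def by (intro conjI ballI refl) (simp_all only: pbd par week_sizes)
  moreover have "has_partition_m1_2 W (weeks v base) (2 * k)"
    unfolding has_partition_m1_2_def by (intro ballI) (simp only: week_sizes sizes)
  ultimately show ?thesis
    unfolding Let_def W_def[symmetric] base_def[symmetric] using cardW by (intro conjI)
qed

end
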